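(* For any centered Gaussian random vector $(X_1,X_2,X_3,X_4)$ (each $X_i$ real-valued with positive variance), $$E[X_1^{4}X_2^{2}X_3^{2}X_4^{2}]\ge E[X_1^{4}]\,E[X_2^{2}]\,E[X_3^{2}]\,E[X_4^{2}],$$ and equality holds if and only if $X_1,X_2,X_3,X_4$ are independent.
   Context: All Gaussian random variables are assumed real-valued and non-degenerate (positive variance). *)

theory Defs
  imports "HOL-Probability.Probability"
begin

text \<open>A family of real random variables (X i) indexed by a finite set I is a
centered (jointly) Gaussian vector if every linear combination is a centered
normal random variable, where the degenerate case (variance 0, i.e. a.s. zero)
is allowed. Here normal_density 0 s is the N(0, s^2) density.\<close>

definition centered_gaussian_family ::
  "'a measure \<Rightarrow> 'i set \<Rightarrow> ('i \<Rightarrow> 'a \<Rightarrow> real) \<Rightarrow> bool" where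
  "centered_gaussian_family M I X \<longleftrightarrow>
     (\<forall>i\<in>I. X i \<in> borel_measurable M) \<and>
     (\<forall>c :: 'i \<Rightarrow> real.
        (AE \<omega> in M. (\<Sum>i\<in>I. c i * X i \<omega>) = 0) \<or>
        (\<exists>s>0. distributed M lborel (\<lambda>\<omega>. \<Sum>i\<in>I. c i * X i \<omega>) (normal_density 0 s)))"

end

theory Submission
  imports Defs "HOL-Computational_Algebra.Polynomial"
begin

text \<open>Polarising \<open>E[L\<^sup>1\<^sup>0] = 945 E[L\<^sup>2]\<^sup>5\<close> over the linear combinations \<open>L\<close> of the \<open>X\<^sub>i\<close> writes the mixed
moment as a polynomial in the covariances. For unit variances and correlations
\<open>a, b, c = \<rho>\<^sub>1\<^sub>2, \<rho>\<^sub>1\<^sub>3, \<rho>\<^sub>1\<^sub>4\<close> and \<open>x, y, z = \<rho>\<^sub>3\<^sub>4, \<rho>\<^sub>2\<^sub>4, \<rho>\<^sub>2\<^sub>3\<close> it equals \<open>3 + 6 P\<close>, where \<open>3 P\<close> is the sum of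
\<open>x\<^sup>2 + y\<^sup>2 + z\<^sup>2\<close>, of
\<open>2 E[((x + 3bc)X\<^sub>2 + (y + 3ac)X\<^sub>3 + (z + 3ab)X\<^sub>4)\<^sup>2]\<close>, of
\<open>6 E[(aX\<^sub>2 + bX\<^sub>3 + cX\<^sub>4 - (a\<^sup>2 + b\<^sup>2 + c\<^sup>2)X\<^sub>1)\<^sup>2]\<close>, of \<open>3 (2(ax + by + cz) + abc)\<^sup>2\<close>, and of two terms in
\<open>a, b, c\<close> that are nonnegative because \<open>a\<^sup>2 \<le> 1\<close>. Hence \<open>P \<ge> 0\<close>, with equality only if all correlations vanish.
That uncorrelated Gaussians are independent follows by replacing one factor \<open>exp(itX\<^sub>j)\<close> of the joint
characteristic function at a time by an indicator, using the one-dimensional uniqueness theorem.\<close>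

subsection \<open>Moments of centered normal variables\<close>

text \<open>The degenerate case is kept because polarisation runs through all real coefficients, and
  some linear combination of a Gaussian vector may vanish almost surely.\<close>

definition centered_normal :: "'a measure \<Rightarrow> ('a \<Rightarrow> real) \<Rightarrow> bool" where
  "centered_normal M f \<longleftrightarrow> f \<in> borel_measurable M \<and>
     ((AE \<omega> in M. f \<omega> = 0) \<or> (\<exists>s>0. distributed M lborel f (normal_density 0 s)))"

text \<open>Unlike integrability, this property is stable under products and powers, so every
  monomial in the variables is integrable by applying closure rules.\<close>

definition all_moments :: "'a measure \<Rightarrow> ('a \<Rightarrow> real) \<Rightarrow> bool" where
  "all_moments M f \<longleftrightarrow> f \<in> borel_measurable M \<and> (\<forall>n. integrable M (\<lambda>\<omega>. f \<omega> ^ n))"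

lemma centered_normal_measurable: "centered_normal M f \<Longrightarrow> f \<in> borel_measurable M"
  by (simp add: centered_normal_def)

lemma all_moments_integrable: "all_moments M f \<Longrightarrow> integrable M f"
  unfolding all_moments_def using power_one_right[where 'a = real] by (elim conjE allE[where x = 1]) simp

text \<open>The arithmetic-geometric mean inequality gives
  \<open>\<bar>x * y\<bar> ^ n \<le> x ^ (2 * n) + y ^ (2 * n)\<close>, which dominates each moment
  of the product.\<close>

lemma all_moments_mult:
  assumes "all_moments M f" "all_moments M g"
  shows "all_moments M (\<lambda>\<omega>. f \<omega> * g \<omega>)"
proof -
  have [measurable]: "f \<in> borel_measurable M" "g \<in> borel_measurable M"
    using assms by (auto simp: all_moments_def)
  have "integrable M (\<lambda>\<omega>. (f \<omega> * g \<omega>) ^ n)" for n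
  proof (rule Bochner_Integration.integrable_bound)
    show "integrable M (\<lambda>\<omega>. f \<omega> ^ (2 * n) + g \<omega> ^ (2 * n))"
      using assms by (intro Bochner_Integration.integrable_add) (auto simp: all_moments_def)
    have "\<bar>x * y\<bar> ^ n \<le> x ^ (2 * n) + y ^ (2 * n)" for x y :: real
    proof -
      have "2 * (\<bar>x ^ n\<bar> * \<bar>y ^ n\<bar>) \<le> \<bar>x ^ n\<bar>\<^sup>2 + \<bar>y ^ n\<bar>\<^sup>2"
        using sum_squares_bound[of "\<bar>x ^ n\<bar>" "\<bar>y ^ n\<bar>"] by simp
      moreover have "0 \<le> \<bar>x ^ n\<bar> * \<bar>y ^ n\<bar>" by simp
      ultimately have "\<bar>x ^ n\<bar> * \<bar>y ^ n\<bar> \<le> \<bar>x ^ n\<bar>\<^sup>2 + \<bar>y ^ n\<bar>\<^sup>2" by linarith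
      moreover have "z ^ (2 * n) = \<bar>z ^ n\<bar>\<^sup>2" for z :: real
        by (simp add: power_mult[symmetric] mult.commute)
      ultimately show ?thesis
        by (simp add: abs_mult power_mult_distrib power_abs)
    qed
    then show "AE \<omega> in M. norm ((f \<omega> * g \<omega>) ^ n) \<le> norm (f \<omega> ^ (2 * n) + g \<omega> ^ (2 * n))"
      by (intro AE_I2) (simp add: power_abs)
  qed simp
  then show ?thesis by (simp add: all_moments_def)
qed

lemma all_moments_power:
  "all_moments M f \<Longrightarrow> all_moments M (\<lambda>\<omega>. f \<omega> ^ n)"
  unfolding all_moments_def power_mult[symmetric] by (simp add: borel_measurable_power)

context prob_space
begin

text \<open>Rescaling reduces the nondegenerate case to the standard normal law, whose moment of
  order 2k is (2k - 1)!!, written here with factorials. Expressing everything through the second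
  moment covers the degenerate case too. Frequency 1 suffices for the characteristic function, since
  other frequencies are absorbed into the coefficients of a linear combination.\<close>

lemma centered_normal_moments:
  assumes "centered_normal M f"
  shows "all_moments M f"
    and "expectation (\<lambda>\<omega>. f \<omega> ^ (2 * k)) =
           fact (2 * k) / (2 ^ k * fact k) * expectation (\<lambda>\<omega>. (f \<omega>)\<^sup>2) ^ k"
    and "expectation (\<lambda>\<omega>. iexp (f \<omega>)) = complex_of_real (exp (- expectation (\<lambda>\<omega>. (f \<omega>)\<^sup>2) / 2))"
proof -
  have [measurable]: "f \<in> borel_measurable M"
    using assms by (rule centered_normal_measurable)
  consider "AE \<omega> in M. f \<omega> = 0" | s where "s > 0" "distributed M lborel f (normal_density 0 s)"
    using assms by (auto simp: centered_normal_def)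
  then have "all_moments M f \<and> expectation (\<lambda>\<omega>. f \<omega> ^ (2 * k)) =
           fact (2 * k) / (2 ^ k * fact k) * expectation (\<lambda>\<omega>. (f \<omega>)\<^sup>2) ^ k \<and>
      expectation (\<lambda>\<omega>. iexp (f \<omega>)) = complex_of_real (exp (- expectation (\<lambda>\<omega>. (f \<omega>)\<^sup>2) / 2))"
  proof cases
    case 1
    \<comment> \<open>Writing the moments as \<open>0 ^ n\<close> makes the formula correct at k = 0
      as well, where both sides are 1.\<close>
    have pw: "AE \<omega> in M. f \<omega> ^ n = 0 ^ n" for n using 1 by eventually_elim simp
    have "integrable M (\<lambda>\<omega>. f \<omega> ^ n)" for n
      by (subst integrable_cong_AE[OF _ _ pw]) auto
    moreover have eq: "expectation (\<lambda>\<omega>. f \<omega> ^ n) = 0 ^ n" for n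
      by (subst integral_cong_AE[OF _ _ pw]) (auto simp: prob_space)
    moreover have "expectation (\<lambda>\<omega>. iexp (f \<omega>)) = expectation (\<lambda>\<omega>. 1 :: complex)"
      by (rule integral_cong_AE) (use 1 in \<open>auto\<close>)
    ultimately show ?thesis
      using eq[of "2 * k"] eq[of 2] by (simp add: all_moments_def prob_space power_0_left)
  next
    case (2 s)
    define g where "g = (\<lambda>\<omega>. f \<omega> / s)"
    have f: "f = (\<lambda>\<omega>. s * g \<omega>)" using 2 by (auto simp: g_def)
    have D: "distributed M lborel g std_normal_density"
      using 2 normal_standard_normal_convert[of s f 0] by (simp add: g_def)
    have g [measurable]: "g \<in> borel_measurable M" by (simp add: g_def)
    have dg: "distr M borel g = std_normal_distribution"
      using D by (simp add: distributed_def cong: distr_cong)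
    have int: "integrable M (\<lambda>\<omega>. g \<omega> ^ n)" for n
      using integrable_std_normal_distribution_moment[of n]
      by (simp add: dg[symmetric] integrable_distr_eq)
    have ev: "expectation (\<lambda>\<omega>. g \<omega> ^ (2 * n)) = fact (2 * n) / (2 ^ n * fact n)" for n
      using std_normal_distribution_even_moments(1)[of n]
      by (simp add: dg[symmetric] integral_distr)
    have "char std_normal_distribution s = complex_of_real (exp (- (s\<^sup>2) / 2))"
      by (simp add: char_std_normal_distribution)
    then have ch: "expectation (\<lambda>\<omega>. iexp (f \<omega>)) = complex_of_real (exp (- (s\<^sup>2) / 2))"
      by (simp add: dg[symmetric] char_def integral_distr f)
    have "integrable M (\<lambda>\<omega>. f \<omega> ^ n)" for n
      using int[of n] by (simp add: f power_mult_distrib)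
    moreover have eq: "expectation (\<lambda>\<omega>. f \<omega> ^ (2 * n)) = s ^ (2 * n) * (fact (2 * n) / (2 ^ n * fact n))" for n
      using ev[of n] by (simp add: f power_mult_distrib)
    moreover have "expectation (\<lambda>\<omega>. (f \<omega>)\<^sup>2) = s\<^sup>2"
      using eq[of 1] by simp
    ultimately show ?thesis using ch
      by (simp add: all_moments_def power_mult)
  qed
  then show "all_moments M f" "expectation (\<lambda>\<omega>. f \<omega> ^ (2 * k)) =
           fact (2 * k) / (2 ^ k * fact k) * expectation (\<lambda>\<omega>. (f \<omega>)\<^sup>2) ^ k"
      "expectation (\<lambda>\<omega>. iexp (f \<omega>)) = complex_of_real (exp (- expectation (\<lambda>\<omega>. (f \<omega>)\<^sup>2) / 2))"
    by auto
qed

text \<open>Binomial expansion makes the left side of \<open>eq\<close> a polynomial in u as well;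
  agreeing at every real u, the two polynomials have the same coefficients. The weight
  \<open>W\<close> carries the factors split off in earlier rounds.\<close>

lemma polarization_coeff:
  assumes L: "all_moments M L" and H: "all_moments M H" and W: "all_moments M W"
    and eq: "\<And>u. expectation (\<lambda>\<omega>. (L \<omega> + u * H \<omega>) ^ n * W \<omega>) = poly p u"
    and "k \<le> n"
  shows "real (n choose k) * expectation (\<lambda>\<omega>. L \<omega> ^ (n - k) * H \<omega> ^ k * W \<omega>) = coeff p k"
proof -
  define A where "A k = real (n choose k) * expectation (\<lambda>\<omega>. L \<omega> ^ (n - k) * H \<omega> ^ k * W \<omega>)" for k
  have int: "integrable M (\<lambda>\<omega>. L \<omega> ^ i * H \<omega> ^ j * W \<omega>)" for i j
    by (intro all_moments_integrable all_moments_mult all_moments_power L H W)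
  have "poly p u = poly (\<Sum>k\<le>n. monom (A k) k) u" for u
  proof -
    have "(x + u * y) ^ n * w = (\<Sum>k\<le>n. (real (n choose k) * u ^ k) * (x ^ (n - k) * y ^ k * w))"
      for x y w :: real
      unfolding add.commute[of x] binomial_ring sum_distrib_right
      by (intro sum.cong refl) (simp add: power_mult_distrib)
    then have "poly p u = expectation (\<lambda>\<omega>. \<Sum>k\<le>n. (real (n choose k) * u ^ k) * (L \<omega> ^ (n - k) * H \<omega> ^ k * W \<omega>))"
      by (simp only: eq[symmetric])
    also have "\<dots> = (\<Sum>k\<le>n. A k * u ^ k)"
    proof (subst Bochner_Integration.integral_sum)
      show "integrable M (\<lambda>\<omega>. (real (n choose k) * u ^ k) * (L \<omega> ^ (n - k) * H \<omega> ^ k * W \<omega>))" for k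
        by (intro integrable_mult_right int)
    qed (simp only: integral_mult_right_zero, simp only: A_def mult_ac)
    finally show ?thesis by (simp add: poly_sum poly_monom)
  qed
  then have "poly p = poly (\<Sum>k\<le>n. monom (A k) k)"
    by (rule ext)
  then have "p = (\<Sum>k\<le>n. monom (A k) k)"
    by (simp only: poly_eq_poly_eq_iff)
  then have "coeff p k = A k"
    using \<open>k \<le> n\<close> by (simp add: coeff_sum)
  then show ?thesis by (simp add: A_def)
qed

end

section \<open>Mixed moments of Gaussian variables by repeated polarisation\<close>

lemma coeff_mult_Suc_0:
  "coeff (p * q) (Suc 0) = coeff p 0 * coeff q (Suc 0) + coeff p (Suc 0) * coeff q 0"
  by (simp add: coeff_mult)

lemma coeff_mult_Suc_Suc_0:
  "coeff (p * q) (Suc (Suc 0)) =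
     coeff p 0 * coeff q (Suc (Suc 0)) + coeff p (Suc 0) * coeff q (Suc 0) + coeff p (Suc (Suc 0)) * coeff q 0"
  by (simp add: coeff_mult)

lemma power5_eq: "x ^ 5 = x * x * x * x * x" for x :: "'a :: monoid_mult"
  by (simp add: eval_nat_numeral mult.assoc)

text \<open>Only the coefficient of u^2 is ever extracted. These rules compute it recursively from
  coefficients of degree at most two, once powers are unfolded into products, without expanding the
  whole polynomial.\<close>

lemmas low_coeffs = coeff_mult_0 coeff_mult_Suc_0 coeff_mult_Suc_Suc_0

context prob_space
begin

lemma second_moment_add:
  assumes "all_moments M L" "all_moments M H" "all_moments M K"
  shows "expectation (\<lambda>\<omega>. (L \<omega> + u * H \<omega>)\<^sup>2) =
      expectation (\<lambda>\<omega>. (L \<omega>)\<^sup>2) + 2 * u * expectation (\<lambda>\<omega>. L \<omega> * H \<omega>) + u\<^sup>2 * expectation (\<lambda>\<omega>. (H \<omega>)\<^sup>2)"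
    and "expectation (\<lambda>\<omega>. (L \<omega> + u * H \<omega>) * K \<omega>) =
      expectation (\<lambda>\<omega>. L \<omega> * K \<omega>) + u * expectation (\<lambda>\<omega>. H \<omega> * K \<omega>)"
proof -
  have [simp]: "integrable M (\<lambda>\<omega>. L \<omega> * H \<omega>)" "integrable M (\<lambda>\<omega>. L \<omega> * K \<omega>)"
    "integrable M (\<lambda>\<omega>. H \<omega> * K \<omega>)" "integrable M (\<lambda>\<omega>. (L \<omega>)\<^sup>2)" "integrable M (\<lambda>\<omega>. (H \<omega>)\<^sup>2)"
    by (intro all_moments_integrable all_moments_mult all_moments_power assms)+
  have "(\<lambda>\<omega>. (L \<omega> + u * H \<omega>)\<^sup>2) = (\<lambda>\<omega>. (L \<omega>)\<^sup>2 + 2 * u * (L \<omega> * H \<omega>) + u\<^sup>2 * (H \<omega>)\<^sup>2)"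
    by (simp add: fun_eq_iff power2_eq_square algebra_simps)
  then show "expectation (\<lambda>\<omega>. (L \<omega> + u * H \<omega>)\<^sup>2) =
      expectation (\<lambda>\<omega>. (L \<omega>)\<^sup>2) + 2 * u * expectation (\<lambda>\<omega>. L \<omega> * H \<omega>) + u\<^sup>2 * expectation (\<lambda>\<omega>. (H \<omega>)\<^sup>2)"
    by simp
  have "(\<lambda>\<omega>. (L \<omega> + u * H \<omega>) * K \<omega>) = (\<lambda>\<omega>. L \<omega> * K \<omega> + u * (H \<omega> * K \<omega>))"
    by (simp add: fun_eq_iff algebra_simps)
  then show "expectation (\<lambda>\<omega>. (L \<omega> + u * H \<omega>) * K \<omega>) =
      expectation (\<lambda>\<omega>. L \<omega> * K \<omega>) + u * expectation (\<lambda>\<omega>. H \<omega> * K \<omega>)"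
    by simp
qed

text \<open>First round: compare coefficients of u^2 in the tenth moment of L + uK and divide by 45,
  which is 10 choose 2.\<close>

lemma gaussian_moment_8_2:
  assumes normal: "\<And>u. centered_normal M (\<lambda>\<omega>. L \<omega> + u * K \<omega>)"
    and K: "all_moments M K"
  defines "v \<equiv> expectation (\<lambda>\<omega>. (L \<omega>)\<^sup>2)" and "k \<equiv> expectation (\<lambda>\<omega>. (K \<omega>)\<^sup>2)"
    and "d \<equiv> expectation (\<lambda>\<omega>. L \<omega> * K \<omega>)"
  shows "expectation (\<lambda>\<omega>. L \<omega> ^ 8 * (K \<omega>)\<^sup>2) = 105 * v ^ 4 * k + 840 * v ^ 3 * d\<^sup>2"
proof -
  have L: "all_moments M L"
    using centered_normal_moments(1)[OF normal[of 0]] by simp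
  have one: "all_moments M (\<lambda>_. 1)" by (simp add: all_moments_def)
  \<comment> \<open>945 = 9!! is the tenth moment of a standard normal variable, and the quadratic
    is the second moment of L + uK.\<close>
  define p where "p = [:945:] * [:v, 2 * d, k:] ^ 5"
  have "expectation (\<lambda>\<omega>. (L \<omega> + u * K \<omega>) ^ 10 * 1) = poly p u" for u
    using centered_normal_moments(2)[OF normal[of u], of 5]
    by (simp add: second_moment_add[OF L K L] p_def v_def k_def d_def fact_numeral poly_power)
      (simp add: algebra_simps power2_eq_square)
  from polarization_coeff[OF L K one this, of 2]
  have "45 * expectation (\<lambda>\<omega>. L \<omega> ^ 8 * (K \<omega>)\<^sup>2) = coeff p 2"
    by (simp add: choose_two)
  also have "\<dots> = 45 * (105 * v ^ 4 * k + 840 * v ^ 3 * d\<^sup>2)"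
    unfolding p_def power5_eq power4_eq_xxxx power3_eq_cube power2_eq_square numeral_2_eq_2
    by (simp add: low_coeffs algebra_simps)
  finally show ?thesis by simp
qed

text \<open>Second round: the previous formula is applied to L + uJ in place of L, with weight K^2.
  The coefficient of u^2 is divided by 28, which is 8 choose 2.\<close>

lemma gaussian_moment_6_2_2:
  assumes normal: "\<And>s t. centered_normal M (\<lambda>\<omega>. L \<omega> + s * J \<omega> + t * K \<omega>)"
    and J: "all_moments M J" and K: "all_moments M K"
  defines "v \<equiv> expectation (\<lambda>\<omega>. (L \<omega>)\<^sup>2)" and "w \<equiv> expectation (\<lambda>\<omega>. (J \<omega>)\<^sup>2)"
    and "k \<equiv> expectation (\<lambda>\<omega>. (K \<omega>)\<^sup>2)"
    and "c \<equiv> expectation (\<lambda>\<omega>. L \<omega> * J \<omega>)" and "d \<equiv> expectation (\<lambda>\<omega>. L \<omega> * K \<omega>)"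
    and "e \<equiv> expectation (\<lambda>\<omega>. J \<omega> * K \<omega>)"
  shows "expectation (\<lambda>\<omega>. L \<omega> ^ 6 * (J \<omega>)\<^sup>2 * (K \<omega>)\<^sup>2) =
    15 * k * (v ^ 3 * w + 6 * v\<^sup>2 * c\<^sup>2)
    + 30 * (v ^ 3 * e\<^sup>2 + 12 * v\<^sup>2 * c * d * e + 3 * v\<^sup>2 * w * d\<^sup>2 + 12 * v * c\<^sup>2 * d\<^sup>2)"
proof -
  have L: "all_moments M L"
    using centered_normal_moments(1)[OF normal[of 0 0]] by simp
  \<comment> \<open>\<open>[:v, 2 * c, w:]\<close> is the second moment of L + uJ, and
    \<open>[:d, e:]\<close> its covariance with K.\<close>
  define p where "p = [:105:] * [:v, 2 * c, w:] ^ 4 * [:k:] + [:840:] * [:v, 2 * c, w:] ^ 3 * [:d, e:] ^ 2"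
  have "expectation (\<lambda>\<omega>. (L \<omega> + u * J \<omega>) ^ 8 * (K \<omega>)\<^sup>2) = poly p u" for u
    unfolding gaussian_moment_8_2[OF normal K] second_moment_add[OF L J K] p_def
    by (simp add: v_def w_def k_def c_def d_def e_def poly_power) (simp add: algebra_simps power2_eq_square)
  from polarization_coeff[OF L J all_moments_power[OF K] this, of 2]
  have "28 * expectation (\<lambda>\<omega>. L \<omega> ^ 6 * (J \<omega>)\<^sup>2 * (K \<omega>)\<^sup>2) = coeff p 2"
    by (simp add: choose_two)
  also have "\<dots> = 28 * (15 * k * (v ^ 3 * w + 6 * v\<^sup>2 * c\<^sup>2)
    + 30 * (v ^ 3 * e\<^sup>2 + 12 * v\<^sup>2 * c * d * e + 3 * v\<^sup>2 * w * d\<^sup>2 + 12 * v * c\<^sup>2 * d\<^sup>2))"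
    unfolding p_def power5_eq power4_eq_xxxx power3_eq_cube power2_eq_square numeral_2_eq_2
    by (simp add: low_coeffs algebra_simps)
  finally show ?thesis by simp
qed

text \<open>Third round, with L + uH in place of L, weight J^2 K^2 and divisor 15, which is 6 choose
  2. The result is Isserlis' formula for this monomial: the coefficients count pairings of the ten
  factors, and after expansion they add up to 945.\<close>

lemma gaussian_moment_4_2_2_2:
  assumes normal: "\<And>u s t. centered_normal M (\<lambda>\<omega>. L \<omega> + u * H \<omega> + s * J \<omega> + t * K \<omega>)"
    and H: "all_moments M H" and J: "all_moments M J" and K: "all_moments M K"
  defines "v \<equiv> expectation (\<lambda>\<omega>. (L \<omega>)\<^sup>2)" and "m \<equiv> expectation (\<lambda>\<omega>. (H \<omega>)\<^sup>2)"
    and "w \<equiv> expectation (\<lambda>\<omega>. (J \<omega>)\<^sup>2)" and "k \<equiv> expectation (\<lambda>\<omega>. (K \<omega>)\<^sup>2)"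
    and "a \<equiv> expectation (\<lambda>\<omega>. L \<omega> * H \<omega>)" and "b \<equiv> expectation (\<lambda>\<omega>. L \<omega> * J \<omega>)"
    and "c \<equiv> expectation (\<lambda>\<omega>. L \<omega> * K \<omega>)" and "x \<equiv> expectation (\<lambda>\<omega>. J \<omega> * K \<omega>)"
    and "y \<equiv> expectation (\<lambda>\<omega>. H \<omega> * K \<omega>)" and "z \<equiv> expectation (\<lambda>\<omega>. H \<omega> * J \<omega>)"
  shows "expectation (\<lambda>\<omega>. L \<omega> ^ 4 * (H \<omega>)\<^sup>2 * (J \<omega>)\<^sup>2 * (K \<omega>)\<^sup>2) =
    3 * v\<^sup>2 * (m * w * k + 2 * (m * x\<^sup>2 + w * y\<^sup>2 + k * z\<^sup>2) + 8 * x * y * z)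
    + 12 * v * (a\<^sup>2 * (w * k + 2 * x\<^sup>2) + b\<^sup>2 * (m * k + 2 * y\<^sup>2) + c\<^sup>2 * (m * w + 2 * z\<^sup>2))
    + 48 * v * (a * b * (z * k + 2 * x * y) + a * c * (y * w + 2 * x * z) + b * c * (x * m + 2 * y * z))
    + 24 * (a\<^sup>2 * b\<^sup>2 * k + a\<^sup>2 * c\<^sup>2 * w + b\<^sup>2 * c\<^sup>2 * m)
    + 96 * a * b * c * (a * x + b * y + c * z)"
    (is "_ = ?rhs")
proof -
  have L: "all_moments M L"
    using centered_normal_moments(1)[OF normal[of 0 0 0]] by simp
  \<comment> \<open>The second moment of L + uH and its covariances with J and K, as polynomials in
    u.\<close>
  define V B C where "V = [:v, 2 * a, m:]" and "B = [:b, z:]" and "C = [:c, y:]"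
  define p where "p = [:15 * k:] * (V ^ 3 * [:w:] + [:6:] * V\<^sup>2 * B\<^sup>2)
    + [:30:] * (V ^ 3 * [:x\<^sup>2:] + [:12 * x:] * V\<^sup>2 * B * C + [:3 * w:] * V\<^sup>2 * C\<^sup>2 + [:12:] * V * B\<^sup>2 * C\<^sup>2)"
  have "expectation (\<lambda>\<omega>. (L \<omega> + u * H \<omega>) ^ 6 * ((J \<omega>)\<^sup>2 * (K \<omega>)\<^sup>2)) = poly p u" for u
  proof -
    have V: "expectation (\<lambda>\<omega>. (L \<omega> + u * H \<omega>)\<^sup>2) = poly V u"
      by (simp add: second_moment_add[OF L H L] V_def v_def a_def m_def)
        (simp add: algebra_simps power2_eq_square)
    have B: "expectation (\<lambda>\<omega>. (L \<omega> + u * H \<omega>) * J \<omega>) = poly B u"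
      by (simp add: second_moment_add[OF L H J] B_def b_def z_def)
    have C: "expectation (\<lambda>\<omega>. (L \<omega> + u * H \<omega>) * K \<omega>) = poly C u"
      by (simp add: second_moment_add[OF L H K] C_def c_def y_def)
    have "expectation (\<lambda>\<omega>. (L \<omega> + u * H \<omega>) ^ 6 * (J \<omega>)\<^sup>2 * (K \<omega>)\<^sup>2) = poly p u"
      unfolding gaussian_moment_6_2_2[OF normal J K] V B C p_def
      by (simp add: w_def k_def x_def poly_power)
    then show ?thesis by (simp only: mult.assoc)
  qed
  from polarization_coeff[OF L H all_moments_mult[OF all_moments_power[OF J] all_moments_power[OF K]] this, of 2]
  have "15 * expectation (\<lambda>\<omega>. L \<omega> ^ 4 * (H \<omega>)\<^sup>2 * (J \<omega>)\<^sup>2 * (K \<omega>)\<^sup>2) = coeff p 2"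
    by (simp add: choose_two mult.assoc)
  also have "\<dots> = 15 * ?rhs"
    unfolding p_def V_def B_def C_def power4_eq_xxxx power3_eq_cube power2_eq_square numeral_2_eq_2
    by (simp add: low_coeffs algebra_simps)
  finally show ?thesis by simp
qed

end

subsection \<open>Independence from factorising characteristic functions\<close>

context prob_space
begin

lemma integrable_bounded_const:
  fixes W :: "'a \<Rightarrow> 'b :: {banach, second_countable_topology}"
  assumes "W \<in> borel_measurable M" "\<And>\<omega>. norm (W \<omega>) \<le> C"
  shows "integrable M W"
  using assms by (intro integrable_const_bound[where B = C]) auto

lemma char_factor_nonneg:
  fixes h Y :: "'a \<Rightarrow> real"
  assumes h [measurable]: "h \<in> borel_measurable M" and Y [measurable]: "Y \<in> borel_measurable M"
    and nonneg: "\<And>\<omega>. 0 \<le> h \<omega>" and bound: "\<And>\<omega>. h \<omega> \<le> C"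
    and factor: "\<And>t. expectation (\<lambda>\<omega>. h \<omega> * iexp (t * Y \<omega>)) =
        expectation h * expectation (\<lambda>\<omega>. iexp (t * Y \<omega>))"
    and A [measurable]: "A \<in> sets borel"
  shows "expectation (\<lambda>\<omega>. h \<omega> * indicator A (Y \<omega>)) = expectation h * expectation (\<lambda>\<omega>. indicator A (Y \<omega>))"
  \<comment> \<open>Under the law with density \<open>h / E[h]\<close>, the characteristic function of \<open>Y\<close> is unchanged.\<close>
proof (cases "expectation h = 0")
  \<comment> \<open>Normalising \<open>h\<close> to a density is impossible here, but
    \<open>h\<close> then vanishes almost surely and both sides are 0.\<close>
  case True
  have int: "integrable M h"
    using nonneg bound by (intro integrable_bounded_const[where C = C]) auto
  then have "AE \<omega> in M. h \<omega> = 0"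
    using True nonneg integral_nonneg_eq_0_iff_AE by blast
  then have "expectation (\<lambda>\<omega>. h \<omega> * indicator A (Y \<omega>)) = expectation (\<lambda>\<omega>. 0)"
    by (intro integral_cong_AE) auto
  then show ?thesis using True by simp
next
  case False
  define E where "E = expectation h"
  have E: "E > 0"
    using False nonneg by (simp add: E_def integral_nonneg less_le)
  have int: "integrable M h"
    using nonneg bound by (intro integrable_bounded_const[where C = C]) auto
  define N where "N = density M (\<lambda>\<omega>. h \<omega> / E)"
  have [simp]: "AE \<omega> in M. 0 \<le> h \<omega> / E" using nonneg E by simp
  have N: "prob_space N"
  proof
    have "emeasure N (space N) = (\<integral>\<^sup>+ \<omega>. ennreal (h \<omega> / E) \<partial>M)"
      by (simp add: N_def emeasure_density cong: nn_integral_cong)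
    also have "\<dots> = ennreal (expectation (\<lambda>\<omega>. h \<omega> / E))"
      using int by (intro nn_integral_eq_integral) auto
    finally show "emeasure N (space N) = 1" using E by (simp add: E_def)
  qed
  have intN: "integral\<^sup>L N g = expectation (\<lambda>\<omega>. (h \<omega> / E) *\<^sub>R g \<omega>)" if "g \<in> borel_measurable M"
    for g :: "'a \<Rightarrow> 'b :: {banach, second_countable_topology}"
    using that unfolding N_def by (intro integral_density) auto
  have YN [measurable]: "Y \<in> borel_measurable N" by (simp add: N_def)
  have "distr N borel Y = distr M borel Y"
  proof (rule Levy_uniqueness)
    show "real_distribution (distr N borel Y)"
      using prob_space.prob_space_distr[OF N YN] by (simp add: real_distribution_def real_distribution_axioms_def)
    show "real_distribution (distr M borel Y)"
      using prob_space_distr[OF Y] by (simp add: real_distribution_def real_distribution_axioms_def)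
    show "char (distr N borel Y) = char (distr M borel Y)"
    proof
      fix t
      have "char (distr N borel Y) t = expectation (\<lambda>\<omega>. (h \<omega> / E) *\<^sub>R iexp (t * Y \<omega>))"
        by (simp add: char_def integral_distr intN)
      also have "\<dots> = expectation (\<lambda>\<omega>. h \<omega> * iexp (t * Y \<omega>)) / E"
        by (simp add: scaleR_conv_of_real)
      also have "\<dots> = expectation (\<lambda>\<omega>. iexp (t * Y \<omega>))"
        using E by (simp only: factor E_def[symmetric]) simp
      also have "\<dots> = char (distr M borel Y) t"
        by (simp add: char_def integral_distr)
      finally show "char (distr N borel Y) t = char (distr M borel Y) t" .
    qed
  qed
  then have "integral\<^sup>L (distr N borel Y) (indicator A :: real \<Rightarrow> real) = integral\<^sup>L (distr M borel Y) (indicator A)"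
    by simp
  then have "integral\<^sup>L N (\<lambda>\<omega>. indicator A (Y \<omega>) :: real) = expectation (\<lambda>\<omega>. indicator A (Y \<omega>))"
    by (simp only: integral_distr[OF YN borel_measurable_indicator[OF A]] integral_distr[OF Y borel_measurable_indicator[OF A]])
  then have "expectation (\<lambda>\<omega>. h \<omega> * indicator A (Y \<omega>)) / E = expectation (\<lambda>\<omega>. indicator A (Y \<omega>))"
    by (simp add: intN)
  then show ?thesis using E by (simp add: E_def field_simps)
qed

text \<open>Both the hypothesis and the conclusion are linear in the weight and hold for constant
  weights, so the nonnegative weight 1 + R can replace R.\<close>

lemma char_factor_bounded:
  fixes R Y :: "'a \<Rightarrow> real"
  assumes R [measurable]: "R \<in> borel_measurable M" and Y [measurable]: "Y \<in> borel_measurable M"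
    and bound: "\<And>\<omega>. \<bar>R \<omega>\<bar> \<le> 1"
    and factor: "\<And>t. expectation (\<lambda>\<omega>. R \<omega> * iexp (t * Y \<omega>)) =
        expectation R * expectation (\<lambda>\<omega>. iexp (t * Y \<omega>))"
    and A [measurable]: "A \<in> sets borel"
  shows "expectation (\<lambda>\<omega>. R \<omega> * indicator A (Y \<omega>)) = expectation R * expectation (\<lambda>\<omega>. indicator A (Y \<omega>))"
proof -
  have int1: "integrable M R" "integrable M (\<lambda>\<omega>. indicator A (Y \<omega>) :: real)"
    "integrable M (\<lambda>\<omega>. R \<omega> * indicator A (Y \<omega>))"
    using bound by (auto intro!: integrable_bounded_const[where C = 1] simp: indicator_def)
  have int2: "integrable M (\<lambda>\<omega>. iexp (t * Y \<omega>))" "integrable M (\<lambda>\<omega>. R \<omega> * iexp (t * Y \<omega>))" for t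
    using bound by (auto intro!: integrable_bounded_const[where C = 1] simp: norm_mult)
  have "expectation (\<lambda>\<omega>. (1 + R \<omega>) * indicator A (Y \<omega>)) =
      expectation (\<lambda>\<omega>. 1 + R \<omega>) * expectation (\<lambda>\<omega>. indicator A (Y \<omega>))"
  proof (rule char_factor_nonneg[where C = 2])
    show "0 \<le> 1 + R \<omega>" "1 + R \<omega> \<le> 2" for \<omega> using bound[of \<omega>] by auto
    show "expectation (\<lambda>\<omega>. complex_of_real (1 + R \<omega>) * iexp (t * Y \<omega>)) =
        expectation (\<lambda>\<omega>. 1 + R \<omega>) * expectation (\<lambda>\<omega>. iexp (t * Y \<omega>))" for t
      using int1 int2[of t] factor[of t] by (simp add: distrib_right prob_space)
  qed auto
  then show ?thesis using int1 by (simp add: distrib_right prob_space)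
qed

text \<open>The real and imaginary parts of W are combinations of W and its conjugate, so both
  inherit the factorisation and the real case applies to each.\<close>

lemma char_factor_complex:
  fixes W :: "'a \<Rightarrow> complex" and Y :: "'a \<Rightarrow> real"
  assumes W [measurable]: "W \<in> borel_measurable M" and Y [measurable]: "Y \<in> borel_measurable M"
    and bound: "\<And>\<omega>. norm (W \<omega>) \<le> 1"
    and factor: "\<And>t. expectation (\<lambda>\<omega>. W \<omega> * iexp (t * Y \<omega>)) =
        expectation W * expectation (\<lambda>\<omega>. iexp (t * Y \<omega>))"
    and A [measurable]: "A \<in> sets borel"
  shows "expectation (\<lambda>\<omega>. W \<omega> * indicator A (Y \<omega>)) =
    expectation W * complex_of_real (expectation (\<lambda>\<omega>. indicator A (Y \<omega>)))"
proof -
  have int: "integrable M W" "integrable M (\<lambda>\<omega>. cnj (W \<omega>))"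
    "integrable M (\<lambda>\<omega>. W \<omega> * indicator A (Y \<omega>))"
    using bound by (auto intro!: integrable_bounded_const[where C = 1] simp: norm_mult indicator_def)
  have [measurable]: "(\<lambda>\<omega>. cnj (W \<omega>)) \<in> borel_measurable M"
    using int(2) by (rule borel_measurable_integrable)
  have int2: "integrable M (\<lambda>\<omega>. W \<omega> * iexp (t * Y \<omega>))" "integrable M (\<lambda>\<omega>. cnj (W \<omega>) * iexp (t * Y \<omega>))" for t
    using bound by (auto intro!: integrable_bounded_const[where C = 1] simp: norm_mult)
  \<comment> \<open>Conjugation reverses the frequency, so this is the conjugate of
    \<open>factor\<close> at -t.\<close>
  have cnj_factor: "expectation (\<lambda>\<omega>. cnj (W \<omega>) * iexp (t * Y \<omega>)) =
      expectation (\<lambda>\<omega>. cnj (W \<omega>)) * expectation (\<lambda>\<omega>. iexp (t * Y \<omega>))" for t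
  proof -
    have "expectation (\<lambda>\<omega>. cnj (W \<omega>) * iexp (t * Y \<omega>)) = cnj (expectation (\<lambda>\<omega>. W \<omega> * iexp ((- t) * Y \<omega>)))"
      by (simp add: Bochner_Integration.integral_cnj[symmetric] exp_cnj del: Bochner_Integration.integral_cnj)
    also have "\<dots> = cnj (expectation W) * cnj (expectation (\<lambda>\<omega>. iexp ((- t) * Y \<omega>)))"
      by (simp only: factor complex_cnj_mult)
    also have "\<dots> = expectation (\<lambda>\<omega>. cnj (W \<omega>)) * expectation (\<lambda>\<omega>. iexp (t * Y \<omega>))"
      by (simp add: Bochner_Integration.integral_cnj[symmetric] exp_cnj del: Bochner_Integration.integral_cnj)
    finally show ?thesis .
  qed
  have re: "complex_of_real (Re z) = (z + cnj z) / 2" and im: "complex_of_real (Im z) = (- \<i> / 2) * z + (\<i> / 2) * cnj z" for z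
    by (auto simp: complex_eq_iff)
  have R: "expectation (\<lambda>\<omega>. Re (W \<omega>) * indicator A (Y \<omega>)) =
      expectation (\<lambda>\<omega>. Re (W \<omega>)) * expectation (\<lambda>\<omega>. indicator A (Y \<omega>))"
  proof (rule char_factor_bounded)
    show "\<bar>Re (W \<omega>)\<bar> \<le> 1" for \<omega> using abs_Re_le_cmod[of "W \<omega>"] bound[of \<omega>] by simp
    show "expectation (\<lambda>\<omega>. complex_of_real (Re (W \<omega>)) * iexp (t * Y \<omega>)) =
        complex_of_real (expectation (\<lambda>\<omega>. Re (W \<omega>))) * expectation (\<lambda>\<omega>. iexp (t * Y \<omega>))" for t
      using int int2[of t] factor[of t] cnj_factor[of t]
      by (simp add: integral_complex_of_real[symmetric] re add_divide_distrib distrib_right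
          del: integral_complex_of_real)
  qed auto
  have I: "expectation (\<lambda>\<omega>. Im (W \<omega>) * indicator A (Y \<omega>)) =
      expectation (\<lambda>\<omega>. Im (W \<omega>)) * expectation (\<lambda>\<omega>. indicator A (Y \<omega>))"
  proof (rule char_factor_bounded)
    show "\<bar>Im (W \<omega>)\<bar> \<le> 1" for \<omega> using abs_Im_le_cmod[of "W \<omega>"] bound[of \<omega>] by simp
    show "expectation (\<lambda>\<omega>. complex_of_real (Im (W \<omega>)) * iexp (t * Y \<omega>)) =
        complex_of_real (expectation (\<lambda>\<omega>. Im (W \<omega>))) * expectation (\<lambda>\<omega>. iexp (t * Y \<omega>))" for t
      using int int2[of t] factor[of t] cnj_factor[of t]
      by (simp add: integral_complex_of_real[symmetric] im distrib_left distrib_right left_diff_distrib right_diff_distrib diff_divide_distrib mult.assoc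
          del: integral_complex_of_real)
  qed auto
  have ri: "Re (indicator A y) = indicator A y" "Im (indicator A y) = 0" for y
    by (auto simp: indicator_def)
  show ?thesis
    using R I int by (simp add: complex_eq_iff integral_Re[symmetric] integral_Im[symmetric] ri del: integral_Re integral_Im)
qed

text \<open>Working with one variable at a time keeps the argument within the one-dimensional
  uniqueness theorem.\<close>

lemma indep_vars_if_char_factors:
  fixes X :: "'i \<Rightarrow> 'a \<Rightarrow> real"
  assumes I: "finite I" "I \<noteq> {}" and X: "\<And>i. i \<in> I \<Longrightarrow> X i \<in> borel_measurable M"
    and factor: "\<And>c. expectation (\<lambda>\<omega>. iexp (\<Sum>i\<in>I. c i * X i \<omega>)) =
      (\<Prod>i\<in>I. expectation (\<lambda>\<omega>. iexp (c i * X i \<omega>)))"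
  shows "indep_vars (\<lambda>_. borel) X I"
proof -
  \<comment> \<open>J collects the indices whose exponential has already become an indicator: the
    empty J is the hypothesis, and J = I is the product rule for probabilities. The frequencies stay
    arbitrary so that the one at the next index can vary.\<close>
  have step: "expectation (\<lambda>\<omega>. (\<Prod>i\<in>J. indicator (A i) (X i \<omega>)) * iexp (\<Sum>i\<in>I - J. c i * X i \<omega>)) =
      complex_of_real (\<Prod>i\<in>J. expectation (\<lambda>\<omega>. indicator (A i) (X i \<omega>))) *
      (\<Prod>i\<in>I - J. expectation (\<lambda>\<omega>. iexp (c i * X i \<omega>)))"
    if "finite J" "J \<subseteq> I" "\<And>i. i \<in> I \<Longrightarrow> A i \<in> sets borel" for J A c
    using that(1,2)
  proof (induction J arbitrary: c rule: finite_induct)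
    case empty
    show ?case using factor[of c] by simp
  next
    case (insert j J)
    have j: "j \<in> I" "j \<notin> J" and J: "J \<subseteq> I" using insert by auto
    let ?K = "I - insert j J"
    have K: "I - J = insert j ?K" "j \<notin> ?K" "finite ?K" using j I by auto
    have [measurable]: "\<And>i. i \<in> J \<Longrightarrow> X i \<in> borel_measurable M" "\<And>i. i \<in> J \<Longrightarrow> A i \<in> sets borel"
      "\<And>i. i \<in> ?K \<Longrightarrow> X i \<in> borel_measurable M"
      using J X that(3) by auto
    define W where "W \<omega> = (\<Prod>i\<in>J. indicator (A i) (X i \<omega>)) * iexp (\<Sum>i\<in>?K. c i * X i \<omega>)" for \<omega>
    have Wm: "W \<in> borel_measurable M" unfolding W_def by measurable
    have bound: "norm (W \<omega>) \<le> 1" for \<omega>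
      unfolding W_def by (simp add: norm_mult prod_norm[symmetric]) (intro prod_le_1, auto simp: indicator_def)
    \<comment> \<open>The induction hypothesis with frequency t at j and \<open>c\<close> elsewhere
      shows that W, the integrand without its factor at j, factorises against every exponential of
      \<open>X j\<close>.\<close>
    have split: "expectation (\<lambda>\<omega>. W \<omega> * iexp (t * X j \<omega>)) =
        complex_of_real (\<Prod>i\<in>J. expectation (\<lambda>\<omega>. indicator (A i) (X i \<omega>))) *
        (\<Prod>i\<in>?K. expectation (\<lambda>\<omega>. iexp (c i * X i \<omega>))) * expectation (\<lambda>\<omega>. iexp (t * X j \<omega>))" for t
    proof -
      have c: "(\<Sum>i\<in>?K. (c(j := t)) i * X i \<omega>) = (\<Sum>i\<in>?K. c i * X i \<omega>)"
        "(\<Prod>i\<in>?K. expectation (\<lambda>\<omega>. iexp ((c(j := t)) i * X i \<omega>))) = (\<Prod>i\<in>?K. expectation (\<lambda>\<omega>. iexp (c i * X i \<omega>)))" for \<omega>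
        by (auto intro!: sum.cong prod.cong)
      show ?thesis
        using insert.IH[OF J, of "c(j := t)"] unfolding K(1)
        by (simp only: sum.insert[OF K(3,2)] prod.insert[OF K(3,2)] c)
          (simp add: W_def exp_add distrib_left ac_simps)
    qed
    \<comment> \<open>At t = 0 the exponential is 1, which identifies the constant as the
      expectation of W.\<close>
    have W0: "expectation W = complex_of_real (\<Prod>i\<in>J. expectation (\<lambda>\<omega>. indicator (A i) (X i \<omega>))) *
        (\<Prod>i\<in>?K. expectation (\<lambda>\<omega>. iexp (c i * X i \<omega>)))"
      using split[of 0] by (simp add: prob_space)
    have "expectation (\<lambda>\<omega>. W \<omega> * indicator (A j) (X j \<omega>)) =
        expectation W * complex_of_real (expectation (\<lambda>\<omega>. indicator (A j) (X j \<omega>)))"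
      by (rule char_factor_complex[OF Wm X[OF j(1)] bound]) (simp_all only: split W0 that(3) j)
    then show ?case
      using insert.hyps by (simp add: W0) (simp add: W_def ac_simps)
  qed
  have "indep_sets (\<lambda>i. {X i -` A \<inter> space M | A. A \<in> sets borel}) I"
  \<comment> \<open>Each family contains the whole space, so the product rule over all of I already
    includes the one for every subset of indices.\<close>
  proof (subst indep_sets_finite[OF I(2,1)])
    show "{X i -` A \<inter> space M | A. A \<in> sets borel} \<subseteq> events" if "i \<in> I" for i
      using X[OF that] by auto
    show "space M \<in> {X i -` A \<inter> space M | A. A \<in> sets borel}" for i
      by (auto intro!: exI[of _ UNIV])
    show "\<forall>B\<in>Pi I (\<lambda>i. {X i -` A \<inter> space M | A. A \<in> sets borel}). prob (\<Inter>j\<in>I. B j) = (\<Prod>j\<in>I. prob (B j))"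
    proof
      fix B assume "B \<in> Pi I (\<lambda>i. {X i -` A \<inter> space M | A. A \<in> sets borel})"
      then have "\<forall>i\<in>I. \<exists>A. B i = X i -` A \<inter> space M \<and> A \<in> sets borel" by (auto simp: Pi_iff)
      then obtain A where A: "\<And>i. i \<in> I \<Longrightarrow> B i = X i -` A i \<inter> space M" "\<And>i. i \<in> I \<Longrightarrow> A i \<in> sets borel"
        by metis
      have one: "expectation (\<lambda>\<omega>. indicator (A i) (X i \<omega>)) = prob (B i)" if "i \<in> I" for i
      proof -
        have "expectation (\<lambda>\<omega>. indicator (A i) (X i \<omega>) :: real) = expectation (indicator (B i))"
          using A(1)[OF that] by (intro Bochner_Integration.integral_cong) (auto simp: indicator_def)
        moreover have "B i \<in> events"
          using A[OF that] X[OF that] by auto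
        ultimately show ?thesis by simp
      qed
      have "expectation (\<lambda>\<omega>. \<Prod>i\<in>I. indicator (A i) (X i \<omega>) :: complex) = complex_of_real (\<Prod>i\<in>I. prob (B i))"
        using step[of I A "\<lambda>_. 0"] I A(2) one by simp
      moreover have "expectation (\<lambda>\<omega>. \<Prod>i\<in>I. indicator (A i) (X i \<omega>) :: complex) =
          expectation (\<lambda>\<omega>. complex_of_real (indicator (\<Inter>i\<in>I. B i) \<omega>))"
        using A(1) I
        by (intro Bochner_Integration.integral_cong refl)
          (auto simp: indicator_def prod.If_cases prod_zero_iff intro!: prod.neutral)
      moreover have "(\<Inter>i\<in>I. B i) \<in> events"
        using I A X by (intro sets.finite_INT) auto
      ultimately have "complex_of_real (prob (\<Inter>i\<in>I. B i)) = complex_of_real (\<Prod>i\<in>I. prob (B i))"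
        by simp
      then show "prob (\<Inter>i\<in>I. B i) = (\<Prod>i\<in>I. prob (B i))"
        by (simp only: of_real_eq_iff)
    qed
  qed
  then show ?thesis using X by (auto simp: indep_vars_def2)
qed

end

subsection \<open>The inequality\<close>

text \<open>The hypothesis \<open>gram\<close> says that the correlation matrix is positive
  semidefinite. It is evaluated at only three kinds of vector, giving S, D and the bound on a^2; the
  rest is a sum-of-squares identity.\<close>

lemma gram_positivity:
  fixes a b c x y z :: real
  defines "P \<equiv> x\<^sup>2 + y\<^sup>2 + z\<^sup>2 + 4 * x * y * z + 2 * (a\<^sup>2 + b\<^sup>2 + c\<^sup>2)
      + 4 * (a\<^sup>2 * x\<^sup>2 + b\<^sup>2 * y\<^sup>2 + c\<^sup>2 * z\<^sup>2) + 8 * (a * b * z + a * c * y + b * c * x)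
      + 16 * (a * b * x * y + a * c * x * z + b * c * y * z)
      + 4 * (a\<^sup>2 * b\<^sup>2 + a\<^sup>2 * c\<^sup>2 + b\<^sup>2 * c\<^sup>2) + 16 * a * b * c * (a * x + b * y + c * z)"
  assumes gram: "\<And>r s t u. 0 \<le> r\<^sup>2 + s\<^sup>2 + t\<^sup>2 + u\<^sup>2
      + 2 * (r * s * a + r * t * b + r * u * c + s * t * z + s * u * y + t * u * x)"
  shows "P \<ge> 0" and "P = 0 \<Longrightarrow> a = 0 \<and> b = 0 \<and> c = 0 \<and> x = 0 \<and> y = 0 \<and> z = 0"
proof -
  define S where "S = (x + 3 * b * c)\<^sup>2 + (y + 3 * a * c)\<^sup>2 + (z + 3 * a * b)\<^sup>2
      + 2 * ((x + 3 * b * c) * (y + 3 * a * c) * z + (x + 3 * b * c) * (z + 3 * a * b) * y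
           + (y + 3 * a * c) * (z + 3 * a * b) * x)"
  define n where "n = a\<^sup>2 + b\<^sup>2 + c\<^sup>2"
  define D where "D = n\<^sup>2 + a\<^sup>2 + b\<^sup>2 + c\<^sup>2 + 2 * (- n * a * a - n * b * b - n * c * c + a * b * z + a * c * y + b * c * x)"
  define p where "p = a\<^sup>2 * b\<^sup>2 + a\<^sup>2 * c\<^sup>2 + b\<^sup>2 * c\<^sup>2"
  have S: "S \<ge> 0"
    using gram[of 0 "x + 3 * b * c" "y + 3 * a * c" "z + 3 * a * b"] by (simp add: S_def)
  have D: "D \<ge> 0"
    using gram[of "- n" a b c] by (simp add: D_def)
  have a1: "a\<^sup>2 \<le> 1" using gram[of "- a" 1 0 0] by (simp add: power2_eq_square)
  have "(a * b * c)\<^sup>2 \<le> b\<^sup>2 * c\<^sup>2"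
    using mult_right_mono[OF a1, of "b\<^sup>2 * c\<^sup>2"] by (simp add: power_mult_distrib mult.assoc)
  then have abc: "(a * b * c)\<^sup>2 \<le> p" by (simp add: p_def add_increasing)
  have p0: "p \<ge> 0" by (simp add: p_def)
  \<comment> \<open>This makes n^2 - 3p nonnegative, and in the equality case lets p = 0 force n =
    0.\<close>
  have n: "2 * (n\<^sup>2 - 3 * p) = (a\<^sup>2 - b\<^sup>2)\<^sup>2 + (a\<^sup>2 - c\<^sup>2)\<^sup>2 + (b\<^sup>2 - c\<^sup>2)\<^sup>2"
    by (simp add: n_def p_def power2_eq_square algebra_simps)
  have P: "3 * P = x\<^sup>2 + y\<^sup>2 + z\<^sup>2 + 2 * S + 6 * D + 3 * (2 * (a * x + b * y + c * z) + a * b * c)\<^sup>2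
      + 3 * (4 * p - (a * b * c)\<^sup>2) + 6 * (n\<^sup>2 - 3 * p)"
    by (simp add: P_def S_def D_def n_def p_def power2_eq_square algebra_simps)
  define q R where "q = (a * b * c)\<^sup>2" and "R = (2 * (a * x + b * y + c * z) + a * b * c)\<^sup>2"
  have R: "R \<ge> 0" by (simp add: R_def)
  have "q \<le> p" using abc by (simp add: q_def)
  \<comment> \<open>Of the term 3(4p - q) in the identity only 3(p - q) is discarded. The remaining
    9p keeps the lower bound strong enough to decide equality.\<close>
  then have "0 \<le> 2 * S + 6 * D + 3 * R + 3 * (p - q)" using S D R by simp
  also have "\<dots> = 3 * P - (x\<^sup>2 + y\<^sup>2 + z\<^sup>2 + 9 * p + 6 * (n\<^sup>2 - 3 * p))"
    unfolding P q_def R_def by (simp add: algebra_simps)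
  finally have lower: "3 * P \<ge> x\<^sup>2 + y\<^sup>2 + z\<^sup>2 + 9 * p + 6 * (n\<^sup>2 - 3 * p)"
    by simp
  have n0: "n\<^sup>2 - 3 * p \<ge> 0"
    using n by (smt (verit) zero_le_power2)
  show "P \<ge> 0"
    using lower n0 p0 by (smt (verit) zero_le_power2)
  assume "P = 0"
  \<comment> \<open>The lower bound is a sum of nonnegative terms, so all vanish; p = 0 and n^2 - 3p
    = 0 together give n^2 = 0.\<close>
  with lower n0 p0 have "x\<^sup>2 = 0" "y\<^sup>2 = 0" "z\<^sup>2 = 0" "n\<^sup>2 = 0"
    by (smt (verit) zero_le_power2)+
  then show "a = 0 \<and> b = 0 \<and> c = 0 \<and> x = 0 \<and> y = 0 \<and> z = 0"
    unfolding n_def by (simp add: add_nonneg_eq_0_iff)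
qed

section \<open>Linear combinations of a Gaussian family, and independence from vanishing
  covariances\<close>

lemma centered_normal_sum:
  assumes "centered_gaussian_family M I X"
  shows "centered_normal M (\<lambda>\<omega>. \<Sum>i\<in>I. c i * X i \<omega>)"
  using assms unfolding centered_gaussian_family_def centered_normal_def
  by (auto intro!: borel_measurable_sum borel_measurable_times)

lemma centered_normal_component:
  assumes "centered_gaussian_family M I X" "finite I" "i \<in> I"
  shows "centered_normal M (X i)"
proof -
  have "(\<Sum>k\<in>I. (if k = i then 1 else 0) * X k \<omega>) = X i \<omega>" for \<omega>
    using assms by (simp add: if_distrib[of "\<lambda>x. x * _"] cong: if_cong)
  then show ?thesis
    using centered_normal_sum[OF assms(1), of "\<lambda>k. if k = i then 1 else 0"] by simp
qed

context prob_space
begin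

lemma second_moment_sum:
  assumes X: "\<And>i. i \<in> I \<Longrightarrow> all_moments M (X i)"
  shows "expectation (\<lambda>\<omega>. (\<Sum>i\<in>I. c i * X i \<omega>)\<^sup>2) =
    (\<Sum>i\<in>I. \<Sum>j\<in>I. c i * c j * expectation (\<lambda>\<omega>. X i \<omega> * X j \<omega>))"
proof -
  have int: "integrable M (\<lambda>\<omega>. X i \<omega> * X j \<omega>)" if "i \<in> I" "j \<in> I" for i j
    using that by (intro all_moments_integrable all_moments_mult X)
  have "expectation (\<lambda>\<omega>. (\<Sum>i\<in>I. c i * X i \<omega>)\<^sup>2) =
      expectation (\<lambda>\<omega>. \<Sum>i\<in>I. \<Sum>j\<in>I. (c i * c j) * (X i \<omega> * X j \<omega>))"
    by (simp add: power2_eq_square sum_product ac_simps)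
  also have "\<dots> = (\<Sum>i\<in>I. \<Sum>j\<in>I. c i * c j * expectation (\<lambda>\<omega>. X i \<omega> * X j \<omega>))"
    using int by (simp add: Bochner_Integration.integral_sum)
  finally show ?thesis .
qed

text \<open>Without off-diagonal covariances the second moment of a combination is the sum of those
  of its terms, and the exponential in the Gaussian characteristic function turns this sum into a
  product.\<close>

lemma indep_vars_if_uncorrelated:
  assumes G: "centered_gaussian_family M I X" and I: "finite I" "I \<noteq> {}"
    and uncorrelated: "\<And>i j. i \<in> I \<Longrightarrow> j \<in> I \<Longrightarrow> i \<noteq> j \<Longrightarrow> expectation (\<lambda>\<omega>. X i \<omega> * X j \<omega>) = 0"
  shows "indep_vars (\<lambda>_. borel) X I"
proof (rule indep_vars_if_char_factors[OF I])
  note normal = centered_normal_component[OF G I(1)]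
  show "X i \<in> borel_measurable M" if "i \<in> I" for i
    using normal[OF that] by (rule centered_normal_measurable)
  fix c
  have moments: "all_moments M (X i)" if "i \<in> I" for i
    using normal[OF that] by (rule centered_normal_moments(1))
  have single: "expectation (\<lambda>\<omega>. iexp (c i * X i \<omega>)) =
      complex_of_real (exp (- ((c i)\<^sup>2 * expectation (\<lambda>\<omega>. (X i \<omega>)\<^sup>2)) / 2))" if i: "i \<in> I" for i
  proof -
    have "(\<Sum>k\<in>I. (if k = i then c i else 0) * X k \<omega>) = c i * X i \<omega>" for \<omega>
      using I i by (simp add: if_distrib[of "\<lambda>x. x * _"] cong: if_cong)
    then have "centered_normal M (\<lambda>\<omega>. c i * X i \<omega>)"
      using centered_normal_sum[OF G, of "\<lambda>k. if k = i then c i else 0"] by simp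
    from centered_normal_moments(3)[OF this] show ?thesis
      by (simp add: power_mult_distrib)
  qed
  have "(\<Sum>i\<in>I. \<Sum>j\<in>I. c i * c j * expectation (\<lambda>\<omega>. X i \<omega> * X j \<omega>)) =
      (\<Sum>i\<in>I. \<Sum>j\<in>I. if j = i then (c i)\<^sup>2 * expectation (\<lambda>\<omega>. (X i \<omega>)\<^sup>2) else 0)"
    using uncorrelated by (intro sum.cong refl) (auto simp: power2_eq_square)
  also have "\<dots> = (\<Sum>i\<in>I. (c i)\<^sup>2 * expectation (\<lambda>\<omega>. (X i \<omega>)\<^sup>2))"
    using I by simp
  finally have "expectation (\<lambda>\<omega>. (\<Sum>i\<in>I. c i * X i \<omega>)\<^sup>2) = (\<Sum>i\<in>I. (c i)\<^sup>2 * expectation (\<lambda>\<omega>. (X i \<omega>)\<^sup>2))"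
    by (subst second_moment_sum[OF moments])
  then have "expectation (\<lambda>\<omega>. iexp (\<Sum>i\<in>I. c i * X i \<omega>)) =
      complex_of_real (exp (\<Sum>i\<in>I. - ((c i)\<^sup>2 * expectation (\<lambda>\<omega>. (X i \<omega>)\<^sup>2)) / 2))"
    by (simp add: centered_normal_moments(3)[OF centered_normal_sum[OF G]] sum_divide_distrib sum_negf del: of_real_sum)
  also have "\<dots> = (\<Prod>i\<in>I. complex_of_real (exp (- ((c i)\<^sup>2 * expectation (\<lambda>\<omega>. (X i \<omega>)\<^sup>2)) / 2)))"
    using I by (simp only: exp_sum of_real_prod)
  also have "\<dots> = (\<Prod>i\<in>I. expectation (\<lambda>\<omega>. iexp (c i * X i \<omega>)))"
    by (intro prod.cong refl single[symmetric])
  finally show "expectation (\<lambda>\<omega>. iexp (\<Sum>i\<in>I. c i * X i \<omega>)) = (\<Prod>i\<in>I. expectation (\<lambda>\<omega>. iexp (c i * X i \<omega>)))" .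
qed

end

section \<open>Normalisation to correlations, the inequality and its equality case\<close>

theorem theorem3p2:
  fixes M :: "'a measure" and X :: "nat \<Rightarrow> 'a \<Rightarrow> real"
  assumes "prob_space M"
    and "centered_gaussian_family M {1..4} X"
    and "\<forall>i\<in>{1..4}. prob_space.variance M (X i) > 0"
  shows "prob_space.expectation M (\<lambda>\<omega>. X 1 \<omega> ^ 4 * X 2 \<omega> ^ 2 * X 3 \<omega> ^ 2 * X 4 \<omega> ^ 2)
           \<ge> prob_space.expectation M (\<lambda>\<omega>. X 1 \<omega> ^ 4) * prob_space.expectation M (\<lambda>\<omega>. X 2 \<omega> ^ 2)
             * prob_space.expectation M (\<lambda>\<omega>. X 3 \<omega> ^ 2) * prob_space.expectation M (\<lambda>\<omega>. X 4 \<omega> ^ 2)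
     \<and> (prob_space.expectation M (\<lambda>\<omega>. X 1 \<omega> ^ 4 * X 2 \<omega> ^ 2 * X 3 \<omega> ^ 2 * X 4 \<omega> ^ 2)
           = prob_space.expectation M (\<lambda>\<omega>. X 1 \<omega> ^ 4) * prob_space.expectation M (\<lambda>\<omega>. X 2 \<omega> ^ 2)
             * prob_space.expectation M (\<lambda>\<omega>. X 3 \<omega> ^ 2) * prob_space.expectation M (\<lambda>\<omega>. X 4 \<omega> ^ 2)
        \<longleftrightarrow> prob_space.indep_vars M (\<lambda>_. borel) X {1..4})"
proof -
  interpret prob_space M by fact
  have I: "{1..4::nat} = {1, 2, 3, 4}" by auto
  note G = assms(2)
  have normal: "centered_normal M (X i)" if "i \<in> {1..4}" for i
    using centered_normal_component[OF G _ that] by simp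
  have moments: "all_moments M (X i)" if "i \<in> {1..4}" for i
    using normal[OF that] by (rule centered_normal_moments(1))
  define \<sigma> where "\<sigma> i = sqrt (expectation (\<lambda>\<omega>. (X i \<omega>)\<^sup>2))" for i
  define \<rho> where "\<rho> i j = expectation (\<lambda>\<omega>. X i \<omega> * X j \<omega>) / (\<sigma> i * \<sigma> j)" for i j
  \<comment> \<open>The second moment dominates the variance, whatever the mean.\<close>
  have pos: "\<sigma> i > 0" if "i \<in> {1..4}" for i
  proof -
    have "variance (X i) = expectation (\<lambda>\<omega>. (X i \<omega>)\<^sup>2) - (expectation (X i))\<^sup>2"
      using moments[OF that] by (intro variance_eq all_moments_integrable all_moments_power)
    moreover have "variance (X i) > 0" using assms(3) that by blast
    ultimately have "expectation (\<lambda>\<omega>. (X i \<omega>)\<^sup>2) > 0"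
      using zero_le_power2[of "expectation (X i)"] by linarith
    then show ?thesis by (simp add: \<sigma>_def)
  qed
  have var: "expectation (\<lambda>\<omega>. (X i \<omega>)\<^sup>2) = (\<sigma> i)\<^sup>2" for i
    by (simp add: \<sigma>_def)
  have cov: "expectation (\<lambda>\<omega>. X i \<omega> * X j \<omega>) = \<rho> i j * \<sigma> i * \<sigma> j"
    if "i \<in> {1..4}" "j \<in> {1..4}" for i j
    using pos[OF that(1)] pos[OF that(2)] by (simp add: \<rho>_def)
  have sym: "\<rho> i j = \<rho> j i" for i j by (simp add: \<rho>_def mult.commute)
  have diag: "\<rho> i i = 1" if "i \<in> {1..4}" for i
    using pos[OF that] by (simp add: \<rho>_def var power2_eq_square[symmetric])
  \<comment> \<open>This is the second moment of the combination of the normalised variables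
    \<open>X i\<close> / \<open>\<sigma> i\<close> with coefficients r, s, t, u.\<close>
  have gram: "0 \<le> r\<^sup>2 + s\<^sup>2 + t\<^sup>2 + u\<^sup>2 + 2 * (r * s * \<rho> 1 2 + r * t * \<rho> 1 3 + r * u * \<rho> 1 4
      + s * t * \<rho> 2 3 + s * u * \<rho> 2 4 + t * u * \<rho> 3 4)" for r s t u
  proof -
    define d where "d = (\<lambda>_::nat. 0)(1 := r, 2 := s, 3 := t, 4 := u)"
    have "0 \<le> expectation (\<lambda>\<omega>. (\<Sum>i\<in>{1..4}. d i / \<sigma> i * X i \<omega>)\<^sup>2)" by simp
    also have "\<dots> = (\<Sum>i\<in>{1..4}. \<Sum>j\<in>{1..4}. d i / \<sigma> i * (d j / \<sigma> j) * expectation (\<lambda>\<omega>. X i \<omega> * X j \<omega>))"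
      by (rule second_moment_sum[OF moments])
    also have "\<dots> = (\<Sum>i\<in>{1..4}. \<Sum>j\<in>{1..4}. d i * d j * \<rho> i j)"
      by (intro sum.cong refl) (simp add: \<rho>_def)
    also have "\<dots> = r\<^sup>2 + s\<^sup>2 + t\<^sup>2 + u\<^sup>2 + 2 * (r * s * \<rho> 1 2 + r * t * \<rho> 1 3 + r * u * \<rho> 1 4
      + s * t * \<rho> 2 3 + s * u * \<rho> 2 4 + t * u * \<rho> 3 4)"
      using diag unfolding I
      by (simp add: d_def sym[of 2 1] sym[of 3 1] sym[of 4 1] sym[of 3 2] sym[of 4 2] sym[of 4 3]
          power2_eq_square algebra_simps del: One_nat_def)
    finally show ?thesis .
  qed
  \<comment> \<open>The letters x, y, z are matched with a, b, c by complementary index pairs, for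
    instance 34 with 12, which makes P symmetric under permutations of the last three
    variables.\<close>
  define a b c x y z where abc: "a = \<rho> 1 2" "b = \<rho> 1 3" "c = \<rho> 1 4" "x = \<rho> 3 4" "y = \<rho> 2 4" "z = \<rho> 2 3"
  define P where "P = x\<^sup>2 + y\<^sup>2 + z\<^sup>2 + 4 * x * y * z + 2 * (a\<^sup>2 + b\<^sup>2 + c\<^sup>2)
      + 4 * (a\<^sup>2 * x\<^sup>2 + b\<^sup>2 * y\<^sup>2 + c\<^sup>2 * z\<^sup>2) + 8 * (a * b * z + a * c * y + b * c * x)
      + 16 * (a * b * x * y + a * c * x * z + b * c * y * z)
      + 4 * (a\<^sup>2 * b\<^sup>2 + a\<^sup>2 * c\<^sup>2 + b\<^sup>2 * c\<^sup>2) + 16 * a * b * c * (a * x + b * y + c * z)"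
  note positivity = gram_positivity[OF gram, folded abc, folded P_def]
  define K where "K = \<sigma> 1 ^ 4 * (\<sigma> 2)\<^sup>2 * (\<sigma> 3)\<^sup>2 * (\<sigma> 4)\<^sup>2"
  have K: "K > 0" unfolding K_def by (intro mult_pos_pos zero_less_power pos) auto
  \<comment> \<open>The default value 1 of the coefficient function is the coefficient of
    \<open>X 1\<close>.\<close>
  have combination: "centered_normal M (\<lambda>\<omega>. X 1 \<omega> + u * X 2 \<omega> + s * X 3 \<omega> + t * X 4 \<omega>)" for u s t
    using centered_normal_sum[OF G, of "(\<lambda>_. 1)(2 := u, 3 := s, 4 := t)"] unfolding I by (simp add: add.assoc)
  have moments': "all_moments M (X 2)" "all_moments M (X 3)" "all_moments M (X 4)"
    by (simp_all add: moments)
  have cov': "expectation (\<lambda>\<omega>. X 1 \<omega> * X 2 \<omega>) = a * \<sigma> 1 * \<sigma> 2" "expectation (\<lambda>\<omega>. X 1 \<omega> * X 3 \<omega>) = b * \<sigma> 1 * \<sigma> 3"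
    "expectation (\<lambda>\<omega>. X 1 \<omega> * X 4 \<omega>) = c * \<sigma> 1 * \<sigma> 4" "expectation (\<lambda>\<omega>. X 3 \<omega> * X 4 \<omega>) = x * \<sigma> 3 * \<sigma> 4"
    "expectation (\<lambda>\<omega>. X 2 \<omega> * X 4 \<omega>) = y * \<sigma> 2 * \<sigma> 4" "expectation (\<lambda>\<omega>. X 2 \<omega> * X 3 \<omega>) = z * \<sigma> 2 * \<sigma> 3"
    unfolding abc by (rule cov; simp)+
  \<comment> \<open>Every term of Isserlis' formula has degree 4 in \<open>\<sigma> 1\<close> and
    degree 2 in each other \<open>\<sigma> i\<close>, so K factors out. The 3 comes from the product
    of second moments, and 6P collects the terms containing correlations.\<close>
  have lhs: "expectation (\<lambda>\<omega>. X 1 \<omega> ^ 4 * X 2 \<omega> ^ 2 * X 3 \<omega> ^ 2 * X 4 \<omega> ^ 2) = K * (3 + 6 * P)"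
    unfolding gaussian_moment_4_2_2_2[OF combination moments'] var cov' K_def P_def
    by (simp add: power2_eq_square power4_eq_xxxx algebra_simps)
  have "expectation (\<lambda>\<omega>. X 1 \<omega> ^ 4) = 3 * \<sigma> 1 ^ 4"
    using centered_normal_moments(2)[OF normal[of 1], of 2] by (simp add: var fact_numeral power_mult[symmetric])
  then have rhs: "expectation (\<lambda>\<omega>. X 1 \<omega> ^ 4) * expectation (\<lambda>\<omega>. X 2 \<omega> ^ 2) * expectation (\<lambda>\<omega>. X 3 \<omega> ^ 2)
      * expectation (\<lambda>\<omega>. X 4 \<omega> ^ 2) = K * 3"
    by (simp add: var K_def)
  have "indep_vars (\<lambda>_. borel) X {1..4}" if "P = 0"
  proof (rule indep_vars_if_uncorrelated[OF G])
    have "a = 0" "b = 0" "c = 0" "x = 0" "y = 0" "z = 0" using positivity(2)[OF that] by auto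
    then show "expectation (\<lambda>\<omega>. X i \<omega> * X j \<omega>) = 0" if "i \<in> {1..4}" "j \<in> {1..4}" "i \<noteq> j" for i j
      using that cov[OF that(1,2)] unfolding abc I
      by (auto simp: sym[of 2 1] sym[of 3 1] sym[of 4 1] sym[of 3 2] sym[of 4 2] sym[of 4 3] simp del: One_nat_def)
  qed auto
  moreover have "P = 0" if "indep_vars (\<lambda>_. borel) X {1..4}"
  proof -
    \<comment> \<open>With the exponents 4, 2, 2, 2 the product rule for independent variables is
      exactly equality of the two sides, and K > 0 then gives P = 0.\<close>
    define e where "e i = (if i = (1::nat) then 4 else 2 :: nat)" for i
    have "indep_vars (\<lambda>_. borel) (\<lambda>i \<omega>. X i \<omega> ^ e i) {1..4}"
      using that by (rule indep_vars_compose2) simp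
    then have "expectation (\<lambda>\<omega>. \<Prod>i\<in>{1..4}. X i \<omega> ^ e i) = (\<Prod>i\<in>{1..4}. expectation (\<lambda>\<omega>. X i \<omega> ^ e i))"
      by (intro indep_vars_lebesgue_integral all_moments_integrable all_moments_power moments) auto
    then have "K * (3 + 6 * P) = K * 3"
      unfolding I lhs[symmetric] rhs[symmetric] by (simp add: e_def mult.assoc)
    then show ?thesis using K by simp
  qed
  ultimately show ?thesis
    unfolding lhs rhs using positivity(1) K by auto
qed

end
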